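(* Let $\mathcal{M}=((W,R,V),w_d)$ be a pointed model, let $k \geq 0$ and let $<$ be a total order on $W$. Then the $k$-contraction $\mathcal{M}'=((W',R',V'),w'_d)$ of $\mathcal{M}$ with respect to $<$ is a minimal pointed model $k$-bisimilar to $\mathcal{M}$, both world and edge minimal: for every pointed model $((W'',R'',V''),w''_d)$ that is $k$-bisimilar to $\mathcal{M}$, we have $|W'|\le|W''|$ and $|R'_i|\le|R''_i|$ for every $i\in\mathcal{I}$.
   Context: Fix a countable set $\mathcal{P}$ of atomic propositions and a finite set $\mathcal{I}$ of modality indices. A model is $M=(W,R,V)$ with $W$ finite nonempty, $R_i\subseteq W\times W$ for $i\in\mathcal{I}$, $V:\mathcal{P}\to2^W$; a pointed model is $(M,w_d)$ with $w_d\in W$. For $k\ge0$, a $k$-bisimulation between $(M,w_d)$ and $(M',w'_d)$ is a sequence of nonempty relations $Z_k\subseteq\cdots\subseteq Z_0\subseteq W\times W'$ with $(w_d,w'_d)\in Z_k$ such that pairs in $Z_0$ agree on all atoms, and for all $h<k$: if $(w,w')\in Z_{h+1}$ and $wR_iv$ then some $v'$ has $w'R'_iv'$, $(v,v')\in Z_h$ (forth), and symmetrically (back); $k$-bisimilar means such a sequence exists. For worlds of one model, $w\sim_hv$ means $(M,w),(M,v)$ are $h$-bisimilar; $[w]_h=\{v\in W\mid w\sim_hv\}$. With respect to $\mathcal{M}$ and $k$: depth $d(w)$ = length of a shortest path from $w_d$ to $w$ along edges of any $R_i$ ($\infty$ if none); bound $b(w)=k-d(w)$. For $x,y$ with nonnegative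 bound, $x\succ y$ iff $b(x)>b(y)$ and $x\sim_{b(y)}y$. $\mathrm{Max}(W)=\{x\in W\mid b(x)\ge0$ and no $y\in W$ has $y\succ x\}$. For $0\le h\le k$, the least $h$-representative of $w\in W$ is $\ell_h(w)=\min_<\{v\in\mathrm{Max}(W)\mid v\sim_h w\}$. The $k$-contraction of $\mathcal{M}$ with respect to $<$ is $((W',R',V'),[w_d]_{b(w_d)})$ with $W'=\{[x]_{b(x)}\mid x\in\mathrm{Max}(W)\}$; $R'_i=\{([x]_{b(x)},[\ell_{b(x)-1}(y)]_{b(\ell_{b(x)-1}(y))})\mid x\in\mathrm{Max}(W),\ xR_iy,\ b(x)>0\}$; $V'(p)=\{[x]_{b(x)}\mid x\in\mathrm{Max}(W),\ x\in V(p)\}$. *)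

theory Defs
  imports "HOL-Library.Extended_Nat" "HOL-Library.Countable_Set"
begin

text \<open>The set \<open>I\<close> of modality indices and the set \<open>P\<close> of atomic propositions are explicit
  parameters of the notions depending on them, so that either may be empty. The values of
  \<open>acc\<close> outside \<open>I\<close> and of \<open>val\<close> outside \<open>P\<close> are irrelevant.\<close>

record ('w, 'i, 'p) model =
  worlds :: "'w set"
  acc :: "'i \<Rightarrow> ('w \<times> 'w) set"
  val :: "'p \<Rightarrow> 'w set"

type_synonym ('w, 'i, 'p) pointed = "('w, 'i, 'p) model \<times> 'w"

definition is_model :: "'i set \<Rightarrow> 'p set \<Rightarrow> ('w, 'i, 'p) model \<Rightarrow> bool" where
  "is_model I P M \<longleftrightarrow>
     finite (worlds M) \<and> worlds M \<noteq> {} \<and>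
     (\<forall>i\<in>I. acc M i \<subseteq> worlds M \<times> worlds M) \<and>
     (\<forall>p\<in>P. val M p \<subseteq> worlds M)"

definition is_pointed_model :: "'i set \<Rightarrow> 'p set \<Rightarrow> ('w, 'i, 'p) pointed \<Rightarrow> bool" where
  "is_pointed_model I P = (\<lambda>(M, wd). is_model I P M \<and> wd \<in> worlds M)"

text \<open>The sequence \<open>Z\<^sub>k \<subseteq> \<dots> \<subseteq> Z\<^sub>0\<close> is a function on \<open>nat\<close> whose values above \<open>k\<close> are irrelevant.\<close>

definition k_bisimulation ::
  "'i set \<Rightarrow> 'p set \<Rightarrow> nat \<Rightarrow> ('v, 'i, 'p) pointed \<Rightarrow> ('w, 'i, 'p) pointed
     \<Rightarrow> (nat \<Rightarrow> ('v \<times> 'w) set) \<Rightarrow> bool" where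
  "k_bisimulation I P k = (\<lambda>(M, wd) (M', wd') Z.
     (\<forall>h\<le>k. Z h \<noteq> {}) \<and>
     (\<forall>h<k. Z (Suc h) \<subseteq> Z h) \<and>
     Z 0 \<subseteq> worlds M \<times> worlds M' \<and>
     (wd, wd') \<in> Z k \<and>
     (\<forall>(w, w')\<in>Z 0. \<forall>p\<in>P. w \<in> val M p \<longleftrightarrow> w' \<in> val M' p) \<and>
     (\<forall>h<k. \<forall>(w, w')\<in>Z (Suc h). \<forall>i\<in>I.
        (\<forall>v. (w, v) \<in> acc M i \<longrightarrow> (\<exists>v'. (w', v') \<in> acc M' i \<and> (v, v') \<in> Z h)) \<and>
        (\<forall>v'. (w', v') \<in> acc M' i \<longrightarrow> (\<exists>v. (w, v) \<in> acc M i \<and> (v, v') \<in> Z h))))"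

definition k_bisimilar ::
  "'i set \<Rightarrow> 'p set \<Rightarrow> nat \<Rightarrow> ('v, 'i, 'p) pointed \<Rightarrow> ('w, 'i, 'p) pointed \<Rightarrow> bool" where
  "k_bisimilar I P k M M' \<longleftrightarrow> (\<exists>Z. k_bisimulation I P k M M' Z)"

definition bisim_class ::
  "'i set \<Rightarrow> 'p set \<Rightarrow> ('w, 'i, 'p) model \<Rightarrow> nat \<Rightarrow> 'w \<Rightarrow> 'w set" where
  "bisim_class I P M h w = {v \<in> worlds M. k_bisimilar I P h (M, w) (M, v)}"

text \<open>The infimum of the empty set is \<open>\<infinity>\<close>, which is the depth of unreachable worlds.\<close>

definition depth :: "'i set \<Rightarrow> ('w, 'i, 'p) pointed \<Rightarrow> 'w \<Rightarrow> enat" where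
  "depth I = (\<lambda>(M, wd) w. Inf {enat n | n. (wd, w) \<in> (\<Union>i\<in>I. acc M i) ^^ n})"

text \<open>The bound \<open>k - d(w)\<close> is only ever used where it is nonnegative, which is the condition
  \<open>nonneg_bound\<close>. The natural number \<open>bound\<close> is meaningful under that condition only.\<close>

definition nonneg_bound :: "'i set \<Rightarrow> nat \<Rightarrow> ('w, 'i, 'p) pointed \<Rightarrow> 'w \<Rightarrow> bool" where
  "nonneg_bound I k M w \<longleftrightarrow> depth I M w \<le> enat k"

definition bound :: "'i set \<Rightarrow> nat \<Rightarrow> ('w, 'i, 'p) pointed \<Rightarrow> 'w \<Rightarrow> nat" where
  "bound I k M w = k - the_enat (depth I M w)"

definition represents ::
  "'i set \<Rightarrow> 'p set \<Rightarrow> nat \<Rightarrow> ('w, 'i, 'p) pointed \<Rightarrow> 'w \<Rightarrow> 'w \<Rightarrow> bool" where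
  "represents I P k M x y \<longleftrightarrow>
     nonneg_bound I k M x \<and> nonneg_bound I k M y \<and>
     bound I k M x > bound I k M y \<and>
     k_bisimilar I P (bound I k M y) (fst M, x) (fst M, y)"

definition max_worlds ::
  "'i set \<Rightarrow> 'p set \<Rightarrow> nat \<Rightarrow> ('w, 'i, 'p) pointed \<Rightarrow> 'w set" where
  "max_worlds I P k M =
     {x \<in> worlds (fst M). nonneg_bound I k M x \<and>
        \<not> (\<exists>y\<in>worlds (fst M). represents I P k M y x)}"

text \<open>The order \<open><\<close> is given as the set \<open>r\<close> of all pairs \<open>(x, y)\<close> with \<open>x < y\<close>.\<close>

definition least_wrt :: "('w \<times> 'w) set \<Rightarrow> 'w set \<Rightarrow> 'w" where
  "least_wrt r S = (THE v. v \<in> S \<and> (\<forall>u\<in>S. u \<noteq> v \<longrightarrow> (v, u) \<in> r))"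

definition least_rep ::
  "'i set \<Rightarrow> 'p set \<Rightarrow> nat \<Rightarrow> ('w, 'i, 'p) pointed \<Rightarrow> ('w \<times> 'w) set \<Rightarrow> nat \<Rightarrow> 'w \<Rightarrow> 'w" where
  "least_rep I P k M r h w =
     least_wrt r {v \<in> max_worlds I P k M. k_bisimilar I P h (fst M, v) (fst M, w)}"

definition rep_class ::
  "'i set \<Rightarrow> 'p set \<Rightarrow> nat \<Rightarrow> ('w, 'i, 'p) pointed \<Rightarrow> 'w \<Rightarrow> 'w set" where
  "rep_class I P k M x = bisim_class I P (fst M) (bound I k M x) x"

definition k_contraction ::
  "'i set \<Rightarrow> 'p set \<Rightarrow> nat \<Rightarrow> ('w, 'i, 'p) pointed \<Rightarrow> ('w \<times> 'w) set
     \<Rightarrow> ('w set, 'i, 'p) pointed" where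
  "k_contraction I P k M r =
     (\<lparr> worlds = {rep_class I P k M x | x. x \<in> max_worlds I P k M},
        acc = (\<lambda>i. {(rep_class I P k M x,
                     rep_class I P k M (least_rep I P k M r (bound I k M x - 1) y)) | x y.
                     x \<in> max_worlds I P k M \<and> (x, y) \<in> acc (fst M) i \<and> bound I k M x > 0}),
        val = (\<lambda>p. {rep_class I P k M x | x. x \<in> max_worlds I P k M \<and> x \<in> val (fst M) p}) \<rparr>,
      rep_class I P k M (snd M))"

end

theory Submission
  imports Defs
begin

text \<open>Every world \<open>y\<close> of nonnegative bound is \<open>b(y)\<close>-bisimilar to a maximal world whose bound is at
  least \<open>b(y)\<close>. Hence a maximal world that is \<open>h\<close>-bisimilar to \<open>y\<close>, for \<open>h \<le> b(y)\<close>, has bound at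
  least \<open>h\<close>, and the pairs \<open>(w, [x])\<close> with \<open>x\<close> maximal, \<open>h \<le> b(x)\<close> and \<open>w \<sim>\<^sub>h x\<close> form a
  \<open>k\<close>-bisimulation. For minimality, each maximal \<open>x\<close> has a \<open>b(x)\<close>-bisimilar counterpart in any
  competitor. Two maximal worlds \<open>x\<close>, \<open>x'\<close> sharing a counterpart are bisimilar up to the smaller of
  their bounds, so by maximality their bounds agree and their classes coincide. Likewise, edges
  leaving the same class with \<open>(b(x) - 1)\<close>-bisimilar targets have the same least representative as
  target.\<close>

section \<open>Bounded bisimilarity\<close>

text \<open>No nonemptiness premise is required: the root pair lies in \<open>Z k\<close> and
  descends along the inclusions to every lower level.\<close>

lemma k_bisimulationI:
  assumes root: "(w, w') \<in> Z k"
    and mono: "\<And>h. h < k \<Longrightarrow> Z (Suc h) \<subseteq> Z h"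
    and "Z 0 \<subseteq> worlds M \<times> worlds M'"
    and "\<And>x x' p. (x, x') \<in> Z 0 \<Longrightarrow> p \<in> P \<Longrightarrow> x \<in> val M p \<longleftrightarrow> x' \<in> val M' p"
    and "\<And>h x x' i y. h < k \<Longrightarrow> (x, x') \<in> Z (Suc h) \<Longrightarrow> i \<in> I \<Longrightarrow> (x, y) \<in> acc M i
      \<Longrightarrow> \<exists>y'. (x', y') \<in> acc M' i \<and> (y, y') \<in> Z h"
    and "\<And>h x x' i y'. h < k \<Longrightarrow> (x, x') \<in> Z (Suc h) \<Longrightarrow> i \<in> I \<Longrightarrow> (x', y') \<in> acc M' i
      \<Longrightarrow> \<exists>y. (x, y) \<in> acc M i \<and> (y, y') \<in> Z h"
  shows "k_bisimulation I P k (M, w) (M', w') Z"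
proof -
  have "(w, w') \<in> Z h" if "h \<le> k" for h
    using that
  proof (induction rule: inc_induct)
    case (step n)
    then show ?case using mono by blast
  qed (fact root)
  then have "\<forall>h\<le>k. Z h \<noteq> {}" by blast
  then show ?thesis
    unfolding k_bisimulation_def prod.case by (intro conjI) (auto simp: assms)
qed

lemma k_bisimulationD:
  assumes "k_bisimulation I P k (M, w) (M', w') Z"
  shows "(w, w') \<in> Z k" "Z 0 \<subseteq> worlds M \<times> worlds M'"
    "h < k \<Longrightarrow> Z (Suc h) \<subseteq> Z h"
    "(x, x') \<in> Z 0 \<Longrightarrow> p \<in> P \<Longrightarrow> x \<in> val M p \<longleftrightarrow> x' \<in> val M' p"
    "h < k \<Longrightarrow> (x, x') \<in> Z (Suc h) \<Longrightarrow> i \<in> I \<Longrightarrow> (x, y) \<in> acc M i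
      \<Longrightarrow> \<exists>y'. (x', y') \<in> acc M' i \<and> (y, y') \<in> Z h"
    "h < k \<Longrightarrow> (x, x') \<in> Z (Suc h) \<Longrightarrow> i \<in> I \<Longrightarrow> (x', y') \<in> acc M' i
      \<Longrightarrow> \<exists>y. (x, y) \<in> acc M i \<and> (y, y') \<in> Z h"
proof -
  note Z = assms[unfolded k_bisimulation_def prod.case]
  note atoms = Z[THEN conjunct2, THEN conjunct2, THEN conjunct2, THEN conjunct2, THEN conjunct1]
  note step = Z[THEN conjunct2, THEN conjunct2, THEN conjunct2, THEN conjunct2, THEN conjunct2]
  show "(w, w') \<in> Z k" "Z 0 \<subseteq> worlds M \<times> worlds M'" "h < k \<Longrightarrow> Z (Suc h) \<subseteq> Z h"
    using Z by simp_all
  show "(x, x') \<in> Z 0 \<Longrightarrow> p \<in> P \<Longrightarrow> x \<in> val M p \<longleftrightarrow> x' \<in> val M' p"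
    using atoms by fast
  show "h < k \<Longrightarrow> (x, x') \<in> Z (Suc h) \<Longrightarrow> i \<in> I \<Longrightarrow> (x, y) \<in> acc M i
      \<Longrightarrow> \<exists>y'. (x', y') \<in> acc M' i \<and> (y, y') \<in> Z h"
    and "h < k \<Longrightarrow> (x, x') \<in> Z (Suc h) \<Longrightarrow> i \<in> I \<Longrightarrow> (x', y') \<in> acc M' i
      \<Longrightarrow> \<exists>y. (x, y) \<in> acc M i \<and> (y, y') \<in> Z h"
    using step[THEN spec, THEN mp, THEN bspec, of h "(x, x')"] by simp_all
qed

lemma k_bisimulation_chain:
  assumes "k_bisimulation I P k (M, w) (M', w') Z" "h \<le> h'" "h' \<le> k"
  shows "Z h' \<subseteq> Z h"
  using assms(2,3)
proof (induction h' rule: dec_induct)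
  case (step n)
  then show ?case using k_bisimulationD(3)[OF assms(1), of n] by auto
qed simp

lemma k_bisimilar_refl:
  assumes "is_model I P M" "w \<in> worlds M"
  shows "k_bisimilar I P k (M, w) (M, w)"
proof -
  have "k_bisimulation I P k (M, w) (M, w) (\<lambda>_. Id_on (worlds M))"
    using assms by (intro k_bisimulationI) (auto simp: is_model_def Id_on_iff)
  then show ?thesis unfolding k_bisimilar_def by blast
qed

lemma k_bisimilar_sym:
  assumes "k_bisimilar I P k (M, w) (M', w')"
  shows "k_bisimilar I P k (M', w') (M, w)"
proof -
  obtain Z where Z: "k_bisimulation I P k (M, w) (M', w') Z"
    using assms unfolding k_bisimilar_def by blast
  note D = k_bisimulationD[OF Z]
  have "k_bisimulation I P k (M', w') (M, w) (\<lambda>h. (Z h)\<inverse>)"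
    using D(1-3) by (intro k_bisimulationI) (auto simp: D(4) dest: D(5,6))
  then show ?thesis unfolding k_bisimilar_def by blast
qed

lemma k_bisimilar_trans:
  assumes "k_bisimilar I P k (M, w) (M', w')" "k_bisimilar I P k (M', w') (M'', w'')"
  shows "k_bisimilar I P k (M, w) (M'', w'')"
proof -
  obtain Z Y where Z: "k_bisimulation I P k (M, w) (M', w') Z"
    and Y: "k_bisimulation I P k (M', w') (M'', w'') Y"
    using assms unfolding k_bisimilar_def by blast
  note D = k_bisimulationD[OF Z] and E = k_bisimulationD[OF Y]
  have "k_bisimulation I P k (M, w) (M'', w'') (\<lambda>h. Z h O Y h)"
  proof (rule k_bisimulationI)
    show "(w, w'') \<in> Z k O Y k" using D(1) E(1) by blast
    show "Z (Suc h) O Y (Suc h) \<subseteq> Z h O Y h" if "h < k" for h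
      using D(3)[OF that] E(3)[OF that] by (rule relcomp_mono)
    show "Z 0 O Y 0 \<subseteq> worlds M \<times> worlds M''" using D(2) E(2) by blast
  next
    fix x x'' p assume "(x, x'') \<in> Z 0 O Y 0" "p \<in> P"
    then show "x \<in> val M p \<longleftrightarrow> x'' \<in> val M'' p" using D(4) E(4) by blast
  next
    fix h x x'' i
    assume h: "h < k" "i \<in> I" and "(x, x'') \<in> Z (Suc h) O Y (Suc h)"
    then obtain x' where x': "(x, x') \<in> Z (Suc h)" "(x', x'') \<in> Y (Suc h)" by blast
    show "\<exists>v''. (x'', v'') \<in> acc M'' i \<and> (v, v'') \<in> Z h O Y h" if "(x, v) \<in> acc M i" for v
      using D(5)[OF h(1) x'(1) h(2) that] E(5)[OF h(1) x'(2) h(2)] by blast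
    show "\<exists>v. (x, v) \<in> acc M i \<and> (v, v'') \<in> Z h O Y h" if "(x'', v'') \<in> acc M'' i" for v''
      using E(6)[OF h(1) x'(2) h(2) that] D(6)[OF h(1) x'(1) h(2)] by blast
  qed
  then show ?thesis unfolding k_bisimilar_def by blast
qed

text \<open>The same sequence serves: its values above \<open>h\<close> become irrelevant, and the
  chain of inclusions brings the root pair from \<open>Z k\<close> down to
  \<open>Z h\<close>.\<close>

lemma k_bisimilar_mono:
  assumes "k_bisimilar I P k (M, w) (M', w')" "h \<le> k"
  shows "k_bisimilar I P h (M, w) (M', w')"
proof -
  obtain Z where Z: "k_bisimulation I P k (M, w) (M', w') Z"
    using assms unfolding k_bisimilar_def by blast
  have "(w, w') \<in> Z h"
    using Z k_bisimulation_chain[OF Z assms(2)] by (auto simp: k_bisimulation_def)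
  then have "k_bisimulation I P h (M, w) (M', w') Z"
    using Z assms(2) unfolding k_bisimulation_def by simp
  then show ?thesis unfolding k_bisimilar_def by blast
qed

lemma k_bisimilar_forth:
  assumes "k_bisimilar I P (Suc h) (M, w) (M', w')" "i \<in> I" "(w, v) \<in> acc M i"
  obtains v' where "(w', v') \<in> acc M' i" "k_bisimilar I P h (M, v) (M', v')"
proof -
  obtain Z where Z: "k_bisimulation I P (Suc h) (M, w) (M', w') Z"
    using assms unfolding k_bisimilar_def by blast
  then obtain v' where v': "(w', v') \<in> acc M' i" "(v, v') \<in> Z h"
    using k_bisimulationD(5)[OF Z lessI k_bisimulationD(1)[OF Z] assms(2,3)] by blast
  then have "k_bisimulation I P h (M, v) (M', v') Z"
    using Z unfolding k_bisimulation_def by simp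
  then show ?thesis using that v' unfolding k_bisimilar_def by blast
qed

lemma k_bisimilar_back:
  assumes "k_bisimilar I P (Suc h) (M, w) (M', w')" "i \<in> I" "(w', v') \<in> acc M' i"
  obtains v where "(w, v) \<in> acc M i" "k_bisimilar I P h (M, v) (M', v')"
  using k_bisimilar_forth[OF k_bisimilar_sym[OF assms(1)] assms(2,3)] k_bisimilar_sym by metis

lemma k_bisimilar_worlds_val:
  assumes "k_bisimilar I P k (M, w) (M', w')"
  shows "w \<in> worlds M" "w' \<in> worlds M'" "p \<in> P \<Longrightarrow> w \<in> val M p \<longleftrightarrow> w' \<in> val M' p"
proof -
  obtain Z where "k_bisimulation I P 0 (M, w) (M', w') Z"
    using k_bisimilar_mono[OF assms le0] unfolding k_bisimilar_def by blast
  then show "w \<in> worlds M" "w' \<in> worlds M'" "p \<in> P \<Longrightarrow> w \<in> val M p \<longleftrightarrow> w' \<in> val M' p"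
    unfolding k_bisimulation_def by auto
qed

text \<open>Each edge of the path is matched by the back condition at the cost of one level, so a
  path of length \<open>n\<close> leaves \<open>k - n\<close> levels. This supplies counterparts in
  a competitor for worlds reachable in the original model.\<close>

lemma k_bisimilar_path:
  assumes "k_bisimilar I P k (M', w') (M, w)" "(w, x) \<in> (\<Union>i\<in>I. acc M i) ^^ n" "n \<le> k"
  shows "\<exists>x'. k_bisimilar I P (k - n) (M', x') (M, x)"
  using assms(2,3)
proof (induction n arbitrary: x)
  case 0
  then show ?case using assms(1) by auto
next
  case (Suc n)
  then obtain y i where y: "(w, y) \<in> (\<Union>i\<in>I. acc M i) ^^ n" "i \<in> I" "(y, x) \<in> acc M i"
    by auto
  with Suc obtain y' where "k_bisimilar I P (k - n) (M', y') (M, y)" by auto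
  \<comment> \<open>Since \<open>n < k\<close>, the truncated difference \<open>k - n\<close> is a
    successor, as the back condition demands.\<close>
  then have "k_bisimilar I P (Suc (k - Suc n)) (M', y') (M, y)"
    using Suc.prems(2) by (simp add: Suc_diff_Suc)
  then show ?case using k_bisimilar_back y(2,3) by metis
qed

section \<open>Depth, bounds and least elements\<close>

lemma depth_le_path:
  assumes "(wd, x) \<in> (\<Union>i\<in>I. acc M i) ^^ n"
  shows "depth I (M, wd) x \<le> enat n"
  using assms unfolding depth_def by (auto intro: Inf_lower)

text \<open>A finite infimum rules out the empty set, whose infimum is infinite; an infimum over a
  nonempty set in a well-order is attained.\<close>

lemma path_of_depth:
  assumes "depth I (M, wd) x = enat n"
  shows "(wd, x) \<in> (\<Union>i\<in>I. acc M i) ^^ n"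
proof -
  let ?A = "{enat n | n. (wd, x) \<in> (\<Union>i\<in>I. acc M i) ^^ n}"
  have Inf: "Inf ?A = enat n" using assms by (simp add: depth_def)
  then have "?A \<noteq> {}" by (metis Inf_empty enat.distinct(1) top_enat_def)
  then have "Inf ?A \<in> ?A" by (rule wellorder_InfI[OF ex_in_conv[THEN iffD2, THEN someI_ex]])
  then show ?thesis using Inf by auto
qed

text \<open>With nonnegative bound the truncated subtraction defining \<open>bound\<close> loses
  nothing, so \<open>k - bound\<close> recovers the depth.\<close>

lemma path_of_bound:
  assumes "nonneg_bound I k (M, wd) x"
  shows "bound I k (M, wd) x \<le> k"
    "(wd, x) \<in> (\<Union>i\<in>I. acc M i) ^^ (k - bound I k (M, wd) x)"
proof -
  obtain n where n: "depth I (M, wd) x = enat n" "n \<le> k"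
    using assms unfolding nonneg_bound_def by (cases "depth I (M, wd) x") auto
  then show "bound I k (M, wd) x \<le> k"
    "(wd, x) \<in> (\<Union>i\<in>I. acc M i) ^^ (k - bound I k (M, wd) x)"
    using path_of_depth[OF n(1)] by (auto simp: bound_def)
qed

lemma bound_ge_path:
  assumes "(wd, x) \<in> (\<Union>i\<in>I. acc M i) ^^ n" "n \<le> k"
  shows "nonneg_bound I k (M, wd) x" "k - n \<le> bound I k (M, wd) x"
proof -
  obtain m where m: "depth I (M, wd) x = enat m" "m \<le> n"
    using depth_le_path[OF assms(1)] by (cases "depth I (M, wd) x") auto
  then show "nonneg_bound I k (M, wd) x" "k - n \<le> bound I k (M, wd) x"
    using assms(2) by (auto simp: nonneg_bound_def bound_def)
qed

text \<open>A shortest path to \<open>x\<close> extended by the edge reaches \<open>y\<close>. Only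
  an inequality results, since \<open>y\<close> may be closer to the root by another route.\<close>

lemma bound_succ:
  assumes "nonneg_bound I k (M, wd) x" "bound I k (M, wd) x > 0" "i \<in> I" "(x, y) \<in> acc M i"
  shows "nonneg_bound I k (M, wd) y" "bound I k (M, wd) x - 1 \<le> bound I k (M, wd) y"
proof -
  let ?b = "bound I k (M, wd) x"
  have "(wd, y) \<in> (\<Union>i\<in>I. acc M i) ^^ Suc (k - ?b)"
    using path_of_bound(2)[OF assms(1)] assms(3,4) by auto
  moreover have "Suc (k - ?b) \<le> k" "k - Suc (k - ?b) = ?b - 1"
    using path_of_bound(1)[OF assms(1)] assms(2) by auto
  ultimately show "nonneg_bound I k (M, wd) y" "?b - 1 \<le> bound I k (M, wd) y"
    using bound_ge_path[of wd y "Suc (k - ?b)" M I k] by auto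
qed

text \<open>The definite description in \<open>least_wrt\<close> denotes only if the least element
  exists uniquely. Induction on the finite set gives existence by totality and transitivity; two
  least elements would lie strictly below each other, against irreflexivity.\<close>

lemma least_wrt_in:
  assumes "strict_linear_order_on W r" "finite S" "S \<noteq> {}" "S \<subseteq> W"
  shows "least_wrt r S \<in> S"
proof -
  have tr: "trans r" "irrefl r" "total_on W r"
    using assms(1) by (auto simp: strict_linear_order_on_def)
  have "\<exists>v\<in>S. \<forall>u\<in>S. u \<noteq> v \<longrightarrow> (v, u) \<in> r"
    using assms(2-4)
  proof (induction S rule: finite_ne_induct)
    case (insert a S)
    then obtain v where v: "v \<in> S" "\<forall>u\<in>S. u \<noteq> v \<longrightarrow> (v, u) \<in> r" by auto
    have "(a, v) \<in> r \<or> (v, a) \<in> r"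
      using tr(3) insert v(1) unfolding total_on_def by (metis insert_subset subsetD)
    then show ?case using v tr(1) by (metis insert_iff transD)
  qed simp
  then have "\<exists>!v. v \<in> S \<and> (\<forall>u\<in>S. u \<noteq> v \<longrightarrow> (v, u) \<in> r)"
    using tr(1,2) by (metis irrefl_def transD)
  from theI'[OF this] show ?thesis unfolding least_wrt_def by blast
qed

section \<open>The contraction\<close>

locale contraction =
  fixes I :: "'i set" and P :: "'p set" and k :: nat
    and M :: "('w, 'i, 'p) model" and wd :: 'w and r :: "('w \<times> 'w) set"
  assumes model: "is_model I P M" and wd: "wd \<in> worlds M"
    and order: "strict_linear_order_on (worlds M) r"
begin

abbreviation sim :: "nat \<Rightarrow> 'w \<Rightarrow> 'w \<Rightarrow> bool" where
  "sim h x y \<equiv> k_bisimilar I P h (M, x) (M, y)"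

abbreviation b :: "'w \<Rightarrow> nat" where
  "b \<equiv> bound I k (M, wd)"

abbreviation nonneg :: "'w \<Rightarrow> bool" where
  "nonneg \<equiv> nonneg_bound I k (M, wd)"

abbreviation Mx :: "'w set" where
  "Mx \<equiv> max_worlds I P k (M, wd)"

abbreviation cl :: "'w \<Rightarrow> 'w set" where
  "cl \<equiv> rep_class I P k (M, wd)"

abbreviation lrep :: "nat \<Rightarrow> 'w \<Rightarrow> 'w" where
  "lrep \<equiv> least_rep I P k (M, wd) r"

abbreviation C :: "('w set, 'i, 'p) pointed" where
  "C \<equiv> k_contraction I P k (M, wd) r"

lemma finite_worlds: "finite (worlds M)"
  using model by (simp add: is_model_def)

lemma sim_cong:
  assumes "sim h x y"
  shows "sim h x z \<longleftrightarrow> sim h y z" "sim h z x \<longleftrightarrow> sim h z y"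
  using k_bisimilar_trans[OF assms] k_bisimilar_trans[OF k_bisimilar_sym[OF assms]]
    k_bisimilar_trans[OF _ assms] k_bisimilar_trans[OF _ k_bisimilar_sym[OF assms]]
  by auto

lemma Mx_worlds: "x \<in> Mx \<Longrightarrow> x \<in> worlds M"
  and Mx_nonneg: "x \<in> Mx \<Longrightarrow> nonneg x"
  by (auto simp: max_worlds_def)

lemma acc_worlds: "i \<in> I \<Longrightarrow> (x, y) \<in> acc M i \<Longrightarrow> y \<in> worlds M"
  using model by (auto simp: is_model_def)

section \<open>Maximal worlds and their classes\<close>

lemma Mx_bound_le:
  assumes "x \<in> Mx" "nonneg y" "sim (b x) x y"
  shows "b y \<le> b x"
proof (rule ccontr)
  assume "\<not> b y \<le> b x"
  then have "represents I P k (M, wd) y x"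
    using assms Mx_nonneg k_bisimilar_sym[OF assms(3)] by (simp add: represents_def)
  then show False
    using assms(1) k_bisimilar_worlds_val(2)[OF assms(3)] by (auto simp: max_worlds_def)
qed

text \<open>Take \<open>x\<close> of largest bound in the finite set \<open>?S\<close>. A world
  representing \<open>x\<close> would belong to \<open>?S\<close> again, by transitivity, and have a
  larger bound.\<close>

lemma ex_Mx:
  assumes "y \<in> worlds M" "nonneg y"
  obtains x where "x \<in> Mx" "b y \<le> b x" "sim (b y) x y"
proof -
  let ?S = "{x \<in> worlds M. nonneg x \<and> b y \<le> b x \<and> sim (b y) x y}"
  have "finite ?S" "?S \<noteq> {}"
    using assms finite_worlds k_bisimilar_refl[OF model] by auto
  then obtain x where x: "x \<in> ?S" and max: "\<And>z. z \<in> ?S \<Longrightarrow> b z \<le> b x"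
    using finite_has_maximal[of "b ` ?S"]
    by (smt (verit) Max_ge Max_in finite_imageI image_iff image_is_empty)
  have "\<not> represents I P k (M, wd) z x" if "z \<in> worlds M" for z
  proof
    assume "represents I P k (M, wd) z x"
    then have z: "nonneg z" "b z > b x" "sim (b x) z x" by (auto simp: represents_def)
    have "sim (b y) z y"
      using k_bisimilar_mono[OF z(3), of "b y"] x sim_cong(1)[of "b y" z x y] by simp
    then show False using max[of z] z that x by auto
  qed
  then have "x \<in> Mx" using x by (auto simp: max_worlds_def)
  then show ?thesis using x that by blast
qed

text \<open>If \<open>b z < h\<close>, the maximal world \<open>x\<close> found for \<open>y\<close>
  is \<open>b z\<close>-bisimilar to \<open>z\<close> through \<open>y\<close> and has bound above
  \<open>b z\<close>, so it would represent \<open>z\<close>. This keeps edge targets of the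
  contraction at a sufficient bound.\<close>

lemma Mx_bound_ge:
  assumes "z \<in> Mx" "nonneg y" "h \<le> b y" "sim h z y"
  shows "h \<le> b z"
proof (rule ccontr)
  assume less: "\<not> h \<le> b z"
  obtain x where x: "x \<in> Mx" "b y \<le> b x" "sim (b y) x y"
    using ex_Mx[OF k_bisimilar_worlds_val(2)[OF assms(4)] assms(2)] by blast
  have "sim (b z) z x"
    using k_bisimilar_trans[OF k_bisimilar_mono[OF assms(4)]
        k_bisimilar_mono[OF k_bisimilar_sym[OF x(3)]], of "b z"] less assms(3) by simp
  then show False using Mx_bound_le[OF assms(1) Mx_nonneg[OF x(1)]] x(2) less assms(3) by simp
qed

text \<open>Were the bounds different, the world with the larger one would represent the
  other.\<close>

lemma Mx_class_eq:
  assumes "x \<in> Mx" "y \<in> Mx" "sim (min (b x) (b y)) x y"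
  shows "b x = b y" "cl x = cl y"
proof -
  show eq: "b x = b y"
  proof (rule antisym)
    show "b y \<le> b x"
      using Mx_bound_le[OF assms(1) Mx_nonneg[OF assms(2)]] assms(3)
      by (cases "b x \<le> b y") (auto simp: min_def)
    show "b x \<le> b y"
      using Mx_bound_le[OF assms(2) Mx_nonneg[OF assms(1)]] k_bisimilar_sym[OF assms(3)]
      by (cases "b x \<le> b y") (auto simp: min_def)
  qed
  then have "sim (b y) x y" using assms(3) by simp
  then show "cl x = cl y"
    using sim_cong(1)[of "b y" x y] by (simp add: rep_class_def bisim_class_def eq)
qed

text \<open>Equality of the two sets does not by itself reveal the levels at which the classes were
  taken. Maximality shows that these agree, so facts about a class can be moved between its maximal
  members.\<close>

lemma Mx_class_eqD:
  assumes "x \<in> Mx" "y \<in> Mx" "cl x = cl y"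
  shows "b x = b y" "sim (b x) x y"
proof -
  have "y \<in> cl x"
    unfolding assms(3) using k_bisimilar_refl[OF model] Mx_worlds[OF assms(2)]
    by (simp add: rep_class_def bisim_class_def)
  then show s: "sim (b x) x y" by (simp add: rep_class_def bisim_class_def)
  show "b x = b y"
    by (rule Mx_class_eq[OF assms(1,2) k_bisimilar_mono[OF s]]) simp
qed

section \<open>Least representatives and the root\<close>

lemma lrep_props:
  assumes "y \<in> worlds M" "nonneg y" "h \<le> b y"
  shows "lrep h y \<in> Mx" "sim h (lrep h y) y" "h \<le> b (lrep h y)"
proof -
  let ?S = "{v \<in> Mx. sim h v y}"
  obtain x where x: "x \<in> Mx" "sim (b y) x y" using ex_Mx[OF assms(1,2)] by blast
  \<comment> \<open>Because \<open>h <= b y\<close>, the maximal world found for \<open>y\<close> at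
    level \<open>b y\<close> is also a candidate at level \<open>h\<close>.\<close>
  then have "?S \<noteq> {}" using k_bisimilar_mono[OF x(2) assms(3)] by auto
  moreover have "?S \<subseteq> worlds M" using Mx_worlds by blast
  ultimately have "least_wrt r ?S \<in> ?S"
    using finite_subset[OF _ finite_worlds] by (intro least_wrt_in[OF order]) auto
  then show "lrep h y \<in> Mx" "sim h (lrep h y) y" by (auto simp: least_rep_def)
  then show "h \<le> b (lrep h y)" using Mx_bound_ge assms(2,3) by blast
qed

lemma lrep_cong:
  assumes "sim h y y'"
  shows "lrep h y = lrep h y'"
  by (simp add: least_rep_def sim_cong(2)[OF assms])

lemma lrep_succ:
  assumes "x \<in> Mx" "i \<in> I" "(x, y) \<in> acc M i" "b x > 0"
  shows "lrep (b x - 1) y \<in> Mx" "sim (b x - 1) (lrep (b x - 1) y) y"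
    "b x - 1 \<le> b (lrep (b x - 1) y)"
  using lrep_props[OF acc_worlds[OF assms(2,3)] bound_succ[OF Mx_nonneg[OF assms(1)] assms(4,2,3)]]
  by blast+

lemma wd_bound: "nonneg wd" "b wd = k"
  using bound_ge_path[of wd wd 0 M I k] path_of_bound(1)[of I k M wd wd] by auto

text \<open>The root has bound \<open>k\<close>, and no bound exceeds \<open>k\<close>, so nothing
  can represent it.\<close>

lemma wd_Mx: "wd \<in> Mx"
  using wd wd_bound path_of_bound(1) by (fastforce simp: max_worlds_def represents_def)

section \<open>The contraction is a pointed model bisimilar to the original\<close>

lemma contraction_simps:
  "worlds (fst C) = cl ` Mx"
  "acc (fst C) i = {(cl x, cl (lrep (b x - 1) y)) | x y. x \<in> Mx \<and> (x, y) \<in> acc M i \<and> b x > 0}"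
  "val (fst C) p = cl ` (Mx \<inter> val M p)"
  "snd C = cl wd"
  by (auto simp: k_contraction_def)

lemma contraction_is_pointed_model: "is_pointed_model I P C"
proof -
  have "finite Mx" using finite_worlds Mx_worlds by (meson finite_subset subsetI)
  then have "is_model I P (fst C)"
    using wd_Mx lrep_succ(1) unfolding is_model_def contraction_simps by auto
  moreover have "snd C \<in> worlds (fst C)"
    using wd_Mx by (simp add: contraction_simps)
  ultimately show ?thesis by (simp add: is_pointed_model_def case_prod_beta)
qed

lemma contraction_k_bisimilar: "k_bisimilar I P k (M, wd) C"
proof -
  \<comment> \<open>The guard \<open>h <= b x\<close> is essential: a class \<open>cl x\<close> only
    reproduces the behaviour of \<open>x\<close> up to level \<open>b x\<close>, since an edge out
    of \<open>x\<close> is redirected to a world that agrees with its target only up to level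
    \<open>b x - 1\<close>.\<close>
  define Z where "Z h = {(w, cl x) | w x. x \<in> Mx \<and> h \<le> b x \<and> sim h w x}" for h
  have Z_wd: "(wd, cl wd) \<in> Z h" if "h \<le> k" for h
    using wd_Mx wd_bound that k_bisimilar_refl[OF model wd] unfolding Z_def by auto
  have zig: "\<exists>v'. (w', v') \<in> acc (fst C) i \<and> (v, v') \<in> Z h"
    if w: "(w, w') \<in> Z (Suc h)" and i: "i \<in> I" and v: "(w, v) \<in> acc M i" for h w w' i v
  proof -
    obtain x where x: "x \<in> Mx" "Suc h \<le> b x" "sim (Suc h) w x" "w' = cl x"
      using w unfolding Z_def by blast
    obtain y where y: "(x, y) \<in> acc M i" "sim h v y"
      using k_bisimilar_forth[OF x(3) i v] by blast
    have pos: "b x > 0" "h \<le> b x - 1" using x(2) by auto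
    let ?z = "lrep (b x - 1) y"
    note z = lrep_succ[OF x(1) i y(1) pos(1)]
    \<comment> \<open>The edge to \<open>y\<close> is redirected to \<open>?z\<close>, which agrees
      with \<open>y\<close> up to level \<open>b x - 1\<close>, hence up to
      \<open>h\<close>.\<close>
    have "sim h v ?z"
      using k_bisimilar_trans[OF y(2) k_bisimilar_sym[OF k_bisimilar_mono[OF z(2) pos(2)]]] .
    then have "(v, cl ?z) \<in> Z h" using z(1,3) pos(2) unfolding Z_def by fastforce
    moreover have "(w', cl ?z) \<in> acc (fst C) i"
      using x(1,4) y(1) pos(1) unfolding contraction_simps by blast
    ultimately show ?thesis by blast
  qed
  have zag: "\<exists>v. (w, v) \<in> acc M i \<and> (v, v') \<in> Z h"
    if w: "(w, w') \<in> Z (Suc h)" and i: "i \<in> I" and v': "(w', v') \<in> acc (fst C) i" for h w w' i v'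
  proof -
    obtain x0 where x0: "x0 \<in> Mx" "Suc h \<le> b x0" "sim (Suc h) w x0" "w' = cl x0"
      using w unfolding Z_def by blast
    obtain x y where x: "x \<in> Mx" "w' = cl x" "(x, y) \<in> acc M i" "b x > 0"
      and v'_eq: "v' = cl (lrep (b x - 1) y)"
      using v' unfolding contraction_simps by blast
    let ?z = "lrep (b x - 1) y"
    \<comment> \<open>The contracted edge may stem from another maximal member \<open>x\<close> of
      the class than the \<open>x0\<close> related to \<open>w\<close>; both have the same bound and
      are bisimilar up to it, so \<open>x\<close> can replace \<open>x0\<close>.\<close>
    have "b x0 = b x" "sim (b x0) x0 x"
      using Mx_class_eqD[OF x0(1) x(1)] x0(4) x(2) by auto
    then have h: "h \<le> b x - 1" and wx: "sim (Suc h) w x"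
      using k_bisimilar_trans[OF x0(3) k_bisimilar_mono[OF _ x0(2)]] x0(2) by auto
    obtain v where v: "(w, v) \<in> acc M i" "sim h v y"
      using k_bisimilar_back[OF wx i x(3)] by blast
    note z = lrep_succ[OF x(1) i x(3,4)]
    have "sim h v ?z"
      using k_bisimilar_trans[OF v(2) k_bisimilar_sym[OF k_bisimilar_mono[OF z(2) h]]] .
    then have "(v, v') \<in> Z h" using z(1,3) h v'_eq unfolding Z_def by fastforce
    then show ?thesis using v(1) by blast
  qed
  have atoms: "w \<in> val M p \<longleftrightarrow> w' \<in> val (fst C) p" if w: "(w, w') \<in> Z 0" and p: "p \<in> P" for w w' p
  proof -
    obtain x where x: "x \<in> Mx" "sim 0 w x" "w' = cl x"
      using w unfolding Z_def by blast
    \<comment> \<open>The valuation of the class does not depend on the maximal member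
      chosen.\<close>
    have "x \<in> val M p \<longleftrightarrow> y \<in> val M p" if "y \<in> Mx" "cl x = cl y" for y
      using k_bisimilar_worlds_val(3)[OF Mx_class_eqD(2)[OF x(1) that] p] .
    then have "w' \<in> val (fst C) p \<longleftrightarrow> x \<in> val M p"
      using x(1,3) unfolding contraction_simps by blast
    then show ?thesis using k_bisimilar_worlds_val(3)[OF x(2) p] by simp
  qed
  have mono: "Z (Suc h) \<subseteq> Z h" for h
  proof -
    have "sim h w x" if "sim (Suc h) w x" for w x
      using k_bisimilar_mono[OF that] by simp
    then show ?thesis unfolding Z_def using Suc_leD by blast
  qed
  have "Z 0 \<subseteq> worlds M \<times> worlds (fst C)"
    unfolding Z_def contraction_simps using k_bisimilar_worlds_val(1) by auto
  then have "k_bisimulation I P k (M, wd) (fst C, snd C) Z"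
    unfolding contraction_simps(4)
    by (intro k_bisimulationI Z_wd[OF order_refl] mono atoms zig zag)
  then show ?thesis unfolding k_bisimilar_def by auto
qed

section \<open>Minimality among all bisimilar pointed models\<close>

context
  fixes M'' :: "('v, 'i, 'p) model" and wd'' :: 'v
  assumes model'': "is_model I P M''"
    and bisim'': "k_bisimilar I P k (M'', wd'') (M, wd)"
begin

text \<open>A shortest path from the root to \<open>x\<close> has length \<open>k - b x\<close>;
  following it in the competitor leaves exactly \<open>b x\<close> levels.\<close>

lemma ex_counterpart:
  assumes "x \<in> Mx"
  obtains u where "k_bisimilar I P (b x) (M'', u) (M, x)"
  using k_bisimilar_path[OF bisim'' path_of_bound(2)[OF Mx_nonneg[OF assms]]]
    path_of_bound(1)[OF Mx_nonneg[OF assms]] by auto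

lemma counterpart_class_eq:
  assumes "x \<in> Mx" "y \<in> Mx"
    "k_bisimilar I P (b x) (M'', u) (M, x)" "k_bisimilar I P (b y) (M'', u) (M, y)"
  shows "b x = b y" "cl x = cl y"
proof -
  have "sim (min (b x) (b y)) x y"
    using k_bisimilar_trans[OF k_bisimilar_sym[OF k_bisimilar_mono[OF assms(3)]]
        k_bisimilar_mono[OF assms(4)]] by simp
  then show "b x = b y" "cl x = cl y" using Mx_class_eq[OF assms(1,2)] by auto
qed

text \<open>Relating each class to the counterparts of its maximal members is total, and no world is
  related to two classes. This bounds the cardinality without choosing a counterpart for each
  class.\<close>

lemma contraction_world_minimal: "card (worlds (fst C)) \<le> card (worlds M'')"
proof (rule card_le_if_inj_on_rel[where
      r = "\<lambda>c u. \<exists>x\<in>Mx. c = cl x \<and> k_bisimilar I P (b x) (M'', u) (M, x)"])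
  show "finite (worlds M'')" using model'' by (simp add: is_model_def)
  show "\<exists>u. u \<in> worlds M'' \<and> (\<exists>x\<in>Mx. c = cl x \<and> k_bisimilar I P (b x) (M'', u) (M, x))"
    if c: "c \<in> worlds (fst C)" for c
  proof -
    obtain x where x: "x \<in> Mx" "c = cl x"
      using c unfolding contraction_simps by blast
    obtain u where u: "k_bisimilar I P (b x) (M'', u) (M, x)" using ex_counterpart[OF x(1)] .
    then show ?thesis using x k_bisimilar_worlds_val(1)[OF u] by blast
  qed
qed (use counterpart_class_eq(2) in blast)

text \<open>An edge of the contraction is related to edges \<open>(u, v)\<close> matching the
  original edge from \<open>x\<close> to \<open>y\<close>, not its redirected version. Sharing
  \<open>(u, v)\<close> identifies the sources by their common counterpart and makes the original
  targets bisimilar; the fixed choice of the least representative then identifies the redirected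
  targets.\<close>

lemma contraction_edge_minimal:
  assumes i: "i \<in> I"
  shows "card (acc (fst C) i) \<le> card (acc M'' i)"
proof (rule card_le_if_inj_on_rel[where
      r = "\<lambda>e (u, v). \<exists>x y. x \<in> Mx \<and> (x, y) \<in> acc M i \<and> b x > 0 \<and>
        e = (cl x, cl (lrep (b x - 1) y)) \<and> k_bisimilar I P (b x) (M'', u) (M, x) \<and>
        k_bisimilar I P (b x - 1) (M'', v) (M, y)"])
  show "finite (acc M'' i)"
    using model'' i unfolding is_model_def by (meson finite_SigmaI finite_subset)
next
  fix e assume "e \<in> acc (fst C) i"
  then obtain x y where x: "x \<in> Mx" "(x, y) \<in> acc M i" "b x > 0"
    "e = (cl x, cl (lrep (b x - 1) y))"
    unfolding contraction_simps by blast
  obtain u where u: "k_bisimilar I P (b x) (M'', u) (M, x)" using ex_counterpart[OF x(1)] .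
  then have "k_bisimilar I P (Suc (b x - 1)) (M'', u) (M, x)" using x(3) by simp
  from k_bisimilar_back[OF this i x(2)] obtain v
    where "(u, v) \<in> acc M'' i" "k_bisimilar I P (b x - 1) (M'', v) (M, y)" .
  then show "\<exists>f. f \<in> acc M'' i \<and> (case f of (u, v) \<Rightarrow> \<exists>x y. x \<in> Mx \<and> (x, y) \<in> acc M i \<and> b x > 0 \<and>
        e = (cl x, cl (lrep (b x - 1) y)) \<and> k_bisimilar I P (b x) (M'', u) (M, x) \<and>
        k_bisimilar I P (b x - 1) (M'', v) (M, y))"
    using x u by blast
next
  fix e e' f
  let ?rel = "\<lambda>e u v x y. x \<in> Mx \<and> (x, y) \<in> acc M i \<and> b x > 0 \<and>
        e = (cl x, cl (lrep (b x - 1) y)) \<and> k_bisimilar I P (b x) (M'', u) (M, x) \<and>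
        k_bisimilar I P (b x - 1) (M'', v) (M, y)"
  assume "case f of (u, v) \<Rightarrow> \<exists>x y. ?rel e u v x y" "case f of (u, v) \<Rightarrow> \<exists>x y. ?rel e' u v x y"
  then obtain u v x y x' y' where x: "?rel e u v x y" and x': "?rel e' u v x' y'" by blast
  then have eq: "b x = b x'" "cl x = cl x'" using counterpart_class_eq by blast+
  \<comment> \<open>Equal bounds of \<open>x\<close> and \<open>x'\<close> put both bisimilarities
    with \<open>v\<close> at the same level, so they compose.\<close>
  have "sim (b x - 1) y y'"
    using k_bisimilar_trans[OF k_bisimilar_sym] x x' eq(1) by metis
  then show "e = e'" using lrep_cong x x' eq by simp
qed

end

end

theorem theorem5p6:
  fixes I :: "'i set" and P :: "'p set" and k :: nat
    and M :: "('w, 'i, 'p) pointed" and r :: "('w \<times> 'w) set"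
  assumes "finite I" and "countable P"
    and "is_pointed_model I P M"
    and "strict_linear_order_on (worlds (fst M)) r"
  shows "is_pointed_model I P (k_contraction I P k M r) \<and>
    k_bisimilar I P k M (k_contraction I P k M r) \<and>
    (\<forall>M'' :: ('v, 'i, 'p) pointed.
       is_pointed_model I P M'' \<and> k_bisimilar I P k M'' M \<longrightarrow>
         card (worlds (fst (k_contraction I P k M r))) \<le> card (worlds (fst M'')) \<and>
         (\<forall>i\<in>I. card (acc (fst (k_contraction I P k M r)) i) \<le> card (acc (fst M'') i)))"
proof -
  obtain N wd where M: "M = (N, wd)" by fastforce
  interpret contraction I P k N wd r
    using assms(3,4) by unfold_locales (auto simp: M is_pointed_model_def)
  show ?thesis
    unfolding M
  proof (intro conjI allI impI ballI; (elim conjE)?)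
    show "is_pointed_model I P C" by (fact contraction_is_pointed_model)
    show "k_bisimilar I P k (N, wd) C" by (fact contraction_k_bisimilar)
  next
    fix M'' :: "('v, 'i, 'p) pointed"
    assume "is_pointed_model I P M''" "k_bisimilar I P k M'' (N, wd)"
    then have M'': "is_model I P (fst M'')" "k_bisimilar I P k (fst M'', snd M'') (N, wd)"
      by (auto simp: is_pointed_model_def)
    show "card (worlds (fst C)) \<le> card (worlds (fst M''))"
      using contraction_world_minimal[OF M''] .
    show "card (acc (fst C) i) \<le> card (acc (fst M'') i)" if "i \<in> I" for i
      using contraction_edge_minimal[OF M'' that] .
  qed
qed

end
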